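(* Let $B>0$, $\alpha>0$, $\beta>0$ and $p\ge 1$ be real numbers. For every real $b>0$ with $\alpha b<B$, let $H_{\max}(b)$ denote the largest real number $H\ge 0$ such that $\alpha b+\beta b H^{p}\le B$. Then there exists a constant $C>0$ (depending only on $B,\alpha,\beta,p$, and not on $b$) such that for all $b>0$ with $\alpha b<B$, $$H_{\max}(b)\le C\,b^{-1/p}.$$
   Context: In the canonical cost model, reasoning with breadth $b$ (representational size) and depth $H$ (rollout horizon) has cost $\mathrm{Cost}(b,H)=\alpha b+\beta b H^{p}$ with $\alpha,\beta>0$ and $p\ge 1$. For a fixed computational budget $B>0$, a pair $(b,H)$ is admissible if $\mathrm{Cost}(b,H)\le B$, and $H_{\max}(b)$ is the maximal depth $H$ for which $(b,H)$ is admissible. Depth is treated as a nonnegative real variable and breadth as a positive real variable. *)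

theory Defs
  imports Complex_Main
begin

definition cost :: "real \<Rightarrow> real \<Rightarrow> real \<Rightarrow> real \<Rightarrow> real \<Rightarrow> real" where
  "cost \<alpha> \<beta> p b H = \<alpha> * b + \<beta> * b * H powr p"

(* Breadth is a positive and depth a nonnegative real. On H = 0 the convention
   0 powr p = 0 agrees with the usual power, since the exponent p is at least 1. *)
definition admissible :: "real \<Rightarrow> real \<Rightarrow> real \<Rightarrow> real \<Rightarrow> real \<Rightarrow> real \<Rightarrow> bool" where
  "admissible B \<alpha> \<beta> p b H \<longleftrightarrow> b > 0 \<and> H \<ge> 0 \<and> cost \<alpha> \<beta> p b H \<le> B"

(* The maximum over the reals, as a definite description: it is meaningful only when
   the maximum is attained, which is the case for b > 0 with \<alpha> * b < B
   (and B, \<alpha>, \<beta> > 0, p \<ge> 1). *)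
definition H_max :: "real \<Rightarrow> real \<Rightarrow> real \<Rightarrow> real \<Rightarrow> real \<Rightarrow> real" where
  "H_max B \<alpha> \<beta> p b = (GREATEST H. admissible B \<alpha> \<beta> p b H)"

end

theory Submission
  imports Defs
begin

text \<open>For fixed b the budget constraint can be solved for the depth: H is admissible exactly
  when 0 \<le> H \<le> ((B - \<alpha> b) / (\<beta> b))^(1/p), so the right endpoint is the maximum
  (\<open>H_max_eq\<close>). Representation only uses up budget: discarding \<alpha> b leaves (B /
  (\<beta> b))^(1/p), in which b separates as the factor b^(-1/p).\<close>

lemma powr_le_iff_le_powr_inverse:
  fixes x y p :: real
  assumes "x \<ge> 0" "y \<ge> 0" "p > 0"
  shows "x powr p \<le> y \<longleftrightarrow> x \<le> y powr (1 / p)"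
proof -
  \<comment> \<open>With y written as a p-th power, strict monotonicity on the nonnegative reals
    cancels the exponent.\<close>
  have "x powr p \<le> y \<longleftrightarrow> x powr p \<le> (y powr (1 / p)) powr p"
    using assms by (simp add: powr_powr)
  also have "\<dots> \<longleftrightarrow> x \<le> y powr (1 / p)"
    using assms by (meson linorder_not_le powr_ge_zero powr_less_mono2 powr_mono2 less_imp_le)
  finally show ?thesis .
qed

text \<open>The admissible depths form a closed interval starting at 0, so the greatest one exists
  and is its right endpoint. If \<alpha> b = B, the interval is just {0}.\<close>

lemma H_max_eq:
  fixes B \<alpha> \<beta> p b :: real
  assumes "\<beta> > 0" "p > 0" "b > 0" "\<alpha> * b \<le> B"
  shows "H_max B \<alpha> \<beta> p b = ((B - \<alpha> * b) / (\<beta> * b)) powr (1 / p)"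
proof -
  define X where "X = (B - \<alpha> * b) / (\<beta> * b)"
  have "X \<ge> 0"
    using assms by (simp add: X_def)
  have adm: "admissible B \<alpha> \<beta> p b H \<longleftrightarrow> H \<ge> 0 \<and> H \<le> X powr (1 / p)" for H
  proof -
    have "cost \<alpha> \<beta> p b H \<le> B \<longleftrightarrow> H powr p \<le> X"
      using assms by (simp add: cost_def X_def pos_le_divide_eq algebra_simps)
    then show ?thesis
      using assms \<open>X \<ge> 0\<close> powr_le_iff_le_powr_inverse by (auto simp: admissible_def)
  qed
  show ?thesis
    unfolding H_max_def X_def[symmetric] by (rule Greatest_equality) (auto simp: adm)
qed

theorem corollary3p22:
  fixes B \<alpha> \<beta> p :: real
  assumes "B > 0" and "\<alpha> > 0" and "\<beta> > 0" and "p \<ge> 1"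
  shows "\<exists>C::real. C > 0 \<and>
           (\<forall>b::real. b > 0 \<and> \<alpha> * b < B \<longrightarrow> H_max B \<alpha> \<beta> p b \<le> C * b powr (- 1 / p))"
proof (intro exI conjI allI impI)
  \<comment> \<open>This witness for C is what remains of (B / (\<beta> b))^(1/p) once b^(-1/p) is
    split off.\<close>
  show "(B / \<beta>) powr (1 / p) > 0"
    using assms by simp
next
  fix b :: real
  assume b: "b > 0 \<and> \<alpha> * b < B"
  have "H_max B \<alpha> \<beta> p b = ((B - \<alpha> * b) / (\<beta> * b)) powr (1 / p)"
    using assms b by (intro H_max_eq) auto
  \<comment> \<open>The numerator grows from B - \<alpha> b to B; monotonicity of the root applies
    because \<alpha> b < B keeps the smaller base nonnegative.\<close>
  also have "\<dots> \<le> (B / \<beta> / b) powr (1 / p)"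
    using assms b by (intro powr_mono2) (auto simp: divide_right_mono)
  also have "\<dots> = (B / \<beta>) powr (1 / p) * b powr (- 1 / p)"
    using assms b by (simp add: powr_divide powr_minus_divide powr_mult)
  finally show "H_max B \<alpha> \<beta> p b \<le> (B / \<beta>) powr (1 / p) * b powr (- 1 / p)" .
qed

end
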